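(* Let $\lambda\in\mathbb{R}\setminus\{0\}$, let $\rho_*,\sigma_0>0$ and $\omega_0,p_0\in\mathbb{R}$. Set $$\rho_0(x)=\rho_* e^{-\sigma_0x^2},\qquad v_0(x)=\omega_0x+p_0,\qquad x\in\mathbb{R},$$ and consider the ordinary differential equation $$\ddot\gamma=\frac{2\lambda\sigma_0}{\gamma},\qquad \gamma(0)=1,\qquad \dot\gamma(0)=\omega_0. \qquad ( * )$$ Suppose that $( * )$ has a solution $\gamma\in C^2([0,T[)$. Set, for $t\in[0,T[$ and $x\in\mathbb{R}$, $$\rho(t,x)=\frac{\rho_*}{\gamma(t)}e^{-\sigma_0(x-p_0t)^2/\gamma(t)^2},\qquad v(t,x)=\frac{\dot\gamma(t)}{\gamma(t)}(x-p_0t)+p_0.$$ Then $$\mu=\rho(t,x)\,dx\otimes\delta_{\xi=v(t,x)}$$ is a measure solution on $[0,T[$ to the Vlasov equation $$\partial_t f+\xi\,\partial_x f-\lambda\big(\partial_x\ln\rho\big)\partial_\xi f=0,\qquad \rho(t,x)=\int_{\mathbb{R}}f(t,x,d\xi),$$ with $\mu|_{t=0}=\rho_0\,dx\otimes\delta_{\xi=v_0}$. In the case $\lambda>0$, the solution $\gamma$ of $( * )$ is globally defined on $[0,\infty[$ and smooth, so $T$ can be taken arbitrarily large. In addition, it satisfies, as $t\to+\infty$, $$\gamma(t)\sim 2t\sqrt{\lambda\sigma_0\ln t},\qquad \dot\gamma(t)\sim 2\sqrt{\lambda\sigma_0\ln t}.$$ On the other hand, for $\lambda<0$, the solution $\gamma$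 becomes singular in finite time (the maximal solution of $( * )$ for $t\ge0$ has a finite time of existence).
   Context: Here $\delta_{\xi=v(t,x)}$ denotes the Dirac mass in the variable $\xi\in\mathbb{R}$ at the point $v(t,x)$, so that $\mu(t)$ is the measure on $\mathbb{R}_x\times\mathbb{R}_\xi$ with $\int\varphi\,d\mu(t)=\int_{\mathbb{R}}\varphi(x,v(t,x))\rho(t,x)\,dx$. A measure $\mu=\rho\,dx\otimes\delta_{\xi=v}$, with $\rho>0$ and $\rho,v$ of class $C^1$, is a measure solution of the Vlasov equation on $[0,T[$ if the equation holds in the sense of distributions, the force term being understood as $\partial_\xi\big((\partial_x\ln\rho)\mu\big)$; that is, for all $\alpha\in C^1_c(\,]0,T[\times\mathbb{R}^2)$, $$\int_0^T\!\!\int_{\mathbb{R}}\rho(t,x)\Big(\partial_t\alpha+\xi\,\partial_x\alpha-\lambda\,\partial_x\ln\rho(t,x)\,\partial_\xi\alpha\Big)(t,x,\xi)\Big|_{\xi=v(t,x)}dx\,dt=0.$$ The notation $f(t)\sim g(t)$ means $f(t)/g(t)\to1$. *)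

theory Defs
  imports "HOL-Analysis.Analysis" "HOL-Library.Landau_Symbols"
begin

text \<open>The interval \<open>[0,T[\<close>; the end point \<open>T\<close> is an extended real, so that
  \<open>upto_time \<infinity> = {0..}\<close>.\<close>

definition upto_time :: "ereal \<Rightarrow> real set" where
  "upto_time T = {t. 0 \<le> t \<and> ereal t < T}"

text \<open>Derivatives are taken within the set, hence one-sided at end points belonging to it.
  On sets such as \<open>[0,T[\<close> and \<open>[0,T[ \<times> \<real>\<close> they are unique.\<close>

definition C1_on :: "'a::real_normed_vector set \<Rightarrow> ('a \<Rightarrow> real) \<Rightarrow> bool" where
  "C1_on S f \<longleftrightarrow> (\<exists>f'. (\<forall>p\<in>S. (f has_derivative blinfun_apply (f' p)) (at p within S)) \<and>
      continuous_on S f')"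

definition Ck_on :: "nat \<Rightarrow> real set \<Rightarrow> (real \<Rightarrow> real) \<Rightarrow> bool" where
  "Ck_on k J f \<longleftrightarrow> (\<exists>D :: nat \<Rightarrow> real \<Rightarrow> real. (\<forall>t\<in>J. D 0 t = f t) \<and>
      (\<forall>n<k. \<forall>t\<in>J. (D n has_real_derivative D (Suc n) t) (at t within J)) \<and>
      (\<forall>n\<le>k. continuous_on J (D n)))"

definition smooth_on :: "real set \<Rightarrow> (real \<Rightarrow> real) \<Rightarrow> bool" where
  "smooth_on J f \<longleftrightarrow> (\<forall>k. Ck_on k J f)"

definition deriv_within :: "real set \<Rightarrow> (real \<Rightarrow> real) \<Rightarrow> real \<Rightarrow> real" where
  "deriv_within J f t = vector_derivative f (at t within J)"

text \<open>\<open>\<gamma>\<close> is a \<open>C\<^sup>2\<close> solution on \<open>[0,T[\<close> of \<open>\<gamma>'' = 2 lam \<sigma>\<^sub>0/\<gamma>\<close>, \<open>\<gamma>(0) = 1\<close>, \<open>\<gamma>'(0) = \<omega>\<^sub>0\<close>.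
  Since \<open>x / 0 = 0\<close> in HOL, the condition \<open>\<gamma> \<noteq> 0\<close>, needed for the equation to make sense,
  is explicit.\<close>

definition gamma_solution :: "real \<Rightarrow> real \<Rightarrow> real \<Rightarrow> ereal \<Rightarrow> (real \<Rightarrow> real) \<Rightarrow> bool" where
  "gamma_solution lam \<sigma>\<^sub>0 \<omega>\<^sub>0 T \<gamma> \<longleftrightarrow>
     Ck_on 2 (upto_time T) \<gamma> \<and>
     \<gamma> 0 = 1 \<and> deriv_within (upto_time T) \<gamma> 0 = \<omega>\<^sub>0 \<and>
     (\<forall>t\<in>upto_time T. \<gamma> t \<noteq> 0 \<and>
        deriv_within (upto_time T) (deriv_within (upto_time T) \<gamma>) t = 2 * lam * \<sigma>\<^sub>0 / \<gamma> t)"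

text \<open>The maximal solution for \<open>t \<ge> 0\<close>: every solution is a restriction of it. In particular it is
  unique, and \<open>T\<close> is the time of existence.\<close>

definition maximal_gamma_solution :: "real \<Rightarrow> real \<Rightarrow> real \<Rightarrow> ereal \<Rightarrow> (real \<Rightarrow> real) \<Rightarrow> bool" where
  "maximal_gamma_solution lam \<sigma>\<^sub>0 \<omega>\<^sub>0 T \<gamma> \<longleftrightarrow>
     0 < T \<and> gamma_solution lam \<sigma>\<^sub>0 \<omega>\<^sub>0 T \<gamma> \<and>
     (\<forall>T' \<eta>. 0 < T' \<and> gamma_solution lam \<sigma>\<^sub>0 \<omega>\<^sub>0 T' \<eta> \<longrightarrow>
        T' \<le> T \<and> (\<forall>t\<in>upto_time T'. \<eta> t = \<gamma> t))"

text \<open>The measure \<open>\<rho> dx \<otimes> \<delta>\<^bsub>\<xi>=v\<^esub>\<close> on \<open>\<real>\<^sub>x \<times> \<real>\<^sub>\<xi>\<close> is the image of \<open>\<rho> dx\<close> under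
  \<open>x \<mapsto> (x, v(x))\<close>.\<close>

definition monokinetic :: "(real \<Rightarrow> real) \<Rightarrow> (real \<Rightarrow> real) \<Rightarrow> (real \<times> real) measure" where
  "monokinetic \<rho> v = distr (density lborel (\<lambda>x. ennreal (\<rho> x))) borel (\<lambda>x. (x, v x))"

text \<open>\<open>C\<^sup>1\<^sub>c(]0,T[ \<times> \<real>\<^sup>2)\<close>, the functions being extended by zero; the arguments
  are \<open>(t, x, \<xi>)\<close>.\<close>

definition test_function :: "ereal \<Rightarrow> (real \<times> real \<times> real \<Rightarrow> real) \<Rightarrow> bool" where
  "test_function T \<alpha> \<longleftrightarrow> C1_on UNIV \<alpha> \<and>
     compact (closure {p. \<alpha> p \<noteq> 0}) \<and>
     closure {p. \<alpha> p \<noteq> 0} \<subseteq> {t. 0 < t \<and> ereal t < T} \<times> UNIV"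

text \<open>\<open>\<mu>\<close> is a measure solution on \<open>[0,T[\<close>, of the form \<open>\<rho> dx \<otimes> \<delta>\<^bsub>\<xi>=v\<^esub>\<close>, of
  \<open>\<partial>\<^sub>t f + \<xi> \<partial>\<^sub>x f - lam (\<partial>\<^sub>x ln \<rho>) \<partial>\<^sub>\<xi> f = 0\<close>, \<open>\<rho>(t,x) = \<integral> f(t,x,d\<xi>)\<close>.
  The condition on the image of \<open>\<mu> t\<close> under \<open>fst\<close> is the last equation. The integrand of the weak
  formulation is continuous with compact support in \<open>]0,T[ \<times> \<real>\<close>, so the integrals are proper.\<close>

definition vlasov_measure_solution ::
  "real \<Rightarrow> ereal \<Rightarrow> (real \<Rightarrow> real \<Rightarrow> real) \<Rightarrow> (real \<Rightarrow> real \<Rightarrow> real) \<Rightarrow>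
   (real \<Rightarrow> (real \<times> real) measure) \<Rightarrow> bool" where
  "vlasov_measure_solution lam T \<rho> v \<mu> \<longleftrightarrow>
     (\<forall>t\<in>upto_time T. \<forall>x. \<rho> t x > 0) \<and>
     C1_on (upto_time T \<times> UNIV) (\<lambda>(t, x). \<rho> t x) \<and>
     C1_on (upto_time T \<times> UNIV) (\<lambda>(t, x). v t x) \<and>
     (\<forall>t\<in>upto_time T. \<mu> t = monokinetic (\<rho> t) (v t) \<and>
        distr (\<mu> t) borel fst = density lborel (\<lambda>x. ennreal (\<rho> t x))) \<and>
     (\<forall>\<alpha>. test_function T \<alpha> \<longrightarrow>
        (LBINT t=0..T. (LBINT x. \<rho> t x *
           (deriv (\<lambda>s. \<alpha> (s, x, v t x)) t
            + v t x * deriv (\<lambda>y. \<alpha> (t, y, v t x)) x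
            - lam * deriv (\<lambda>y. ln (\<rho> t y)) x * deriv (\<lambda>\<xi>. \<alpha> (t, x, \<xi>)) (v t x)))) = 0)"

unbundle asymp_equiv_syntax

end

theory Submission
  imports Defs "HOL-Real_Asymp.Real_Asymp"
begin

text \<open>Put \<open>c = 2 lam \<sigma>\<^sub>0\<close>. Along a solution of \<open>\<gamma>'' = c/\<gamma>\<close> the slope \<open>p = \<gamma>'\<close> is strictly monotone,
  and conservation of energy gives \<open>\<gamma> = exp ((p\<^sup>2 - \<omega>\<^sub>0\<^sup>2)/(2c))\<close>. Hence the time is an explicit
  function of \<open>p\<close>, the integral of \<open>exp ((q\<^sup>2 - \<omega>\<^sub>0\<^sup>2)/(2c))/c\<close> from \<open>\<omega>\<^sub>0\<close> to \<open>p\<close>, and solving the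
  equation amounts to inverting this function; existence, uniqueness and smoothness follow at once.
  For \<open>c > 0\<close> it maps \<open>\<real>\<close> onto \<open>\<real>\<close>, so the solution is global, and it is equivalent to
  \<open>exp ((p\<^sup>2 - \<omega>\<^sub>0\<^sup>2)/(2c))/p\<close>, whence \<open>ln t \<sim> p\<^sup>2/(2c)\<close> and \<open>\<gamma> \<sim> t p\<close>. For \<open>c < 0\<close> the integral is
  Gaussian and its limit as \<open>p\<close> tends to \<open>-\<infinity>\<close> is the finite time of existence.

  For the Vlasov equation, the change of variable \<open>x = p\<^sub>0 t + \<gamma>(t) y\<close> turns \<open>\<rho> dx\<close> into the fixed
  measure \<open>\<rho>\<^sub>* exp (-\<sigma>\<^sub>0 y\<^sup>2) dy\<close> and the integrand of the weak formulation into the derivative of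
  the test function along the characteristic \<open>t \<mapsto> (t, x, v(t,x))\<close>. Its integral in time vanishes.\<close>

section \<open>The equation for \<open>\<gamma>\<close>\<close>

lemma has_real_derivative_cong_on:
  assumes "(f has_real_derivative D) (at t within J)" "t \<in> J" "\<And>s. s \<in> J \<Longrightarrow> f s = g s"
  shows "(g has_real_derivative D) (at t within J)"
  using assms by (intro has_field_derivative_transform_within[of f D t J 1 g]) simp_all

lemma zero_in_upto_time: "0 < T \<Longrightarrow> 0 \<in> upto_time T"
  by (simp add: upto_time_def zero_ereal_def)

lemma upto_time_PInf: "upto_time \<infinity> = {0..}"
  by (auto simp: upto_time_def)

lemma upto_time_downward: "t \<in> upto_time T \<Longrightarrow> 0 \<le> s \<Longrightarrow> s \<le> t \<Longrightarrow> s \<in> upto_time T"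
  unfolding upto_time_def by (auto intro: le_less_trans[of "ereal s" "ereal t"])

lemma upto_time_nonneg: "t \<in> upto_time T \<Longrightarrow> 0 \<le> t"
  by (simp add: upto_time_def)

lemma convex_upto_time: "convex (upto_time T)"
proof -
  have "is_interval (upto_time T)"
    unfolding is_interval_1
  proof (intro ballI allI impI)
    fix a b x assume "a \<in> upto_time T" "b \<in> upto_time T" "a \<le> x \<and> x \<le> b"
    then show "x \<in> upto_time T"
      using upto_time_downward[of b T x] upto_time_nonneg[of a T] by simp
  qed
  then show ?thesis by (rule is_interval_convex)
qed

text \<open>Because t < T strictly, some [t,s] with s > t stays in the interval, so t can be
  approached from the right even when t = 0. This makes \<open>deriv_within\<close> a genuine,
  unique derivative at every point of [0,T[.\<close>

lemma at_within_upto_time_neq_bot: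
  assumes "t \<in> upto_time T"
  shows "at t within upto_time T \<noteq> bot"
proof
  assume bot: "at t within upto_time T = bot"
  obtain s where s: "ereal t < ereal s" "ereal s < T"
    using assms ereal_dense2[of "ereal t" T] by (auto simp: upto_time_def)
  have "{t..s} \<subseteq> upto_time T"
    using assms s by (auto simp: upto_time_def intro: le_less_trans[of _ "ereal s"])
  then have "at t within {t..s} \<le> at t within upto_time T"
    by (rule at_le)
  then have "at_right t = bot"
    using s bot at_within_Icc_at_right[of t s] by (simp add: bot_unique)
  then show False by simp
qed

lemma deriv_within_upto_time:
  assumes "t \<in> upto_time T" "(f has_real_derivative D) (at t within upto_time T)"
  shows "deriv_within (upto_time T) f t = D"
  unfolding deriv_within_def
  using assms at_within_upto_time_neq_bot
  by (intro vector_derivative_within) (auto simp: has_real_derivative_iff_has_vector_derivative)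

lemma has_real_derivative_deriv_within:
  assumes "t \<in> upto_time T" "(f has_real_derivative D) (at t within upto_time T)"
  shows "(f has_real_derivative deriv_within (upto_time T) f t) (at t within upto_time T)"
  using deriv_within_upto_time[OF assms] assms(2) by simp

section \<open>Properties of an arbitrary solution\<close>

context
  fixes lam \<sigma> \<omega> :: real and T :: ereal and \<gamma> :: "real \<Rightarrow> real"
  assumes T: "0 < T" and sol: "gamma_solution lam \<sigma> \<omega> T \<gamma>"
begin

text \<open>\<open>Ck_on\<close> provides only some family of derivatives. Uniqueness of derivatives
  in the interval identifies its members with the iterated \<open>deriv_within\<close>, so the
  equation between values becomes a differentiability statement.\<close>

lemma gamma_solution_derivs:
  assumes t: "t \<in> upto_time T"
  shows "(\<gamma> has_real_derivative deriv_within (upto_time T) \<gamma> t) (at t within upto_time T)"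
    and "(deriv_within (upto_time T) \<gamma> has_real_derivative 2 * lam * \<sigma> / \<gamma> t)
           (at t within upto_time T)"
proof -
  have "Ck_on 2 (upto_time T) \<gamma>"
    using sol unfolding gamma_solution_def by (rule conjunct1)
  then obtain D where D_all: "(\<forall>t\<in>upto_time T. D 0 t = \<gamma> t) \<and>
      (\<forall>n<2. \<forall>t\<in>upto_time T. (D n has_real_derivative D (Suc n) t) (at t within upto_time T)) \<and>
      (\<forall>n\<le>2. continuous_on (upto_time T) (D n))"
    unfolding Ck_on_def by (rule exE)
  then have D0: "\<And>t. t \<in> upto_time T \<Longrightarrow> D 0 t = \<gamma> t" by simp
  have D: "(D n has_real_derivative D (Suc n) t) (at t within upto_time T)"
    if "n < 2" "t \<in> upto_time T" for n t
    using D_all that by simp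
  have d\<gamma>: "(\<gamma> has_real_derivative D 1 t) (at t within upto_time T)" if "t \<in> upto_time T" for t
    using has_real_derivative_cong_on[of "D 0" _ t, OF D[of 0 t]] D0 that by simp
  have D1: "deriv_within (upto_time T) \<gamma> t = D 1 t" if "t \<in> upto_time T" for t
    using deriv_within_upto_time[OF that d\<gamma>[OF that]] .
  show "(\<gamma> has_real_derivative deriv_within (upto_time T) \<gamma> t) (at t within upto_time T)"
    using d\<gamma>[OF t] D1[OF t] by simp
  have d2: "(deriv_within (upto_time T) \<gamma> has_real_derivative D 2 t) (at t within upto_time T)"
    using has_real_derivative_cong_on[of "D 1" _ t, OF D[of 1 t]] D1 t by (simp add: numeral_2_eq_2)
  have "deriv_within (upto_time T) (deriv_within (upto_time T) \<gamma>) t = 2 * lam * \<sigma> / \<gamma> t"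
    using sol t unfolding gamma_solution_def by blast
  then show "(deriv_within (upto_time T) \<gamma> has_real_derivative 2 * lam * \<sigma> / \<gamma> t)
           (at t within upto_time T)"
    using has_real_derivative_deriv_within[OF t d2] by simp
qed

lemma gamma_solution_initial: "\<gamma> 0 = 1" "deriv_within (upto_time T) \<gamma> 0 = \<omega>"
  using sol unfolding gamma_solution_def by auto

lemma gamma_solution_continuous:
  "continuous_on (upto_time T) \<gamma>" "continuous_on (upto_time T) (deriv_within (upto_time T) \<gamma>)"
  using gamma_solution_derivs by (meson DERIV_continuous continuous_on_eq_continuous_within)+

text \<open>Intermediate value theorem: leaving the positive half-line from the initial value 1
  would produce a zero, which \<open>gamma_solution\<close> excludes.\<close>

lemma gamma_solution_pos:
  assumes t: "t \<in> upto_time T"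
  shows "\<gamma> t > 0"
proof (rule ccontr)
  assume "\<not> \<gamma> t > 0"
  moreover have t0: "0 \<le> t" using t by (simp add: upto_time_def)
  moreover have "{0..t} \<subseteq> upto_time T" using t upto_time_downward by auto
  ultimately obtain s where "0 \<le> s" "s \<le> t" "\<gamma> s = 0"
    using IVT2'[of \<gamma> t 0 0] gamma_solution_initial(1) gamma_solution_continuous(1)
      continuous_on_subset
    by force
  then show False
    using sol t upto_time_downward unfolding gamma_solution_def by blast
qed

text \<open>Conservation of the energy \<open>\<gamma>'\<^sup>2 / 2 - 2 lam \<sigma> ln \<gamma>\<close>.\<close>

lemma gamma_solution_energy:
  assumes t: "t \<in> upto_time T" and c: "lam * \<sigma> \<noteq> 0"
  shows "\<gamma> t = exp (((deriv_within (upto_time T) \<gamma> t)\<^sup>2 - \<omega>\<^sup>2) / (2 * (2 * lam * \<sigma>)))"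
proof -
  let ?p = "deriv_within (upto_time T) \<gamma>"
  let ?H = "\<lambda>t. (?p t)\<^sup>2 / 2 - 2 * lam * \<sigma> * ln (\<gamma> t)"
  have "(?H has_real_derivative 0) (at t within upto_time T)" if t: "t \<in> upto_time T" for t
    using gamma_solution_pos[OF t]
    by (auto intro!: derivative_eq_intros gamma_solution_derivs[OF t])
  then obtain C where C: "\<forall>t\<in>upto_time T. ?H t = C"
    using has_field_derivative_zero_constant[OF convex_upto_time, of T ?H] by auto
  have "?H t = ?H 0"
    using bspec[OF C t] bspec[OF C zero_in_upto_time[OF T]] by (rule trans[OF _ sym])
  then have "ln (\<gamma> t) = ((?p t)\<^sup>2 - \<omega>\<^sup>2) / (2 * (2 * lam * \<sigma>))"
    using c by (simp add: gamma_solution_initial field_simps)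
  then show ?thesis
    using gamma_solution_pos[OF t] by (metis exp_ln)
qed

end

text \<open>\<open>radius p\<close> and \<open>clock p\<close> are the value \<open>\<gamma> t\<close> and the time \<open>t\<close> at which \<open>\<gamma>' t = p\<close>.
  By conservation of energy the former is explicit, and \<open>dt/dp = 1/\<gamma>'' = \<gamma>/c\<close>.\<close>

context
  fixes c \<omega> :: real
begin

definition radius :: "real \<Rightarrow> real" where
  "radius p = exp ((p\<^sup>2 - \<omega>\<^sup>2) / (2 * c))"

definition clock :: "real \<Rightarrow> real" where
  "clock p = (LBINT q=\<omega>..p. radius q / c)"

text \<open>The derivative \<gamma>' as a function of time. Off the range of \<open>clock\<close>
  the value of \<open>inv\<close> is arbitrary, hence the range hypotheses below.\<close>

definition slope :: "real \<Rightarrow> real" where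
  "slope = inv clock"

end

section \<open>Monotonicity and inversion of the clock\<close>

lemma radius_pos: "radius c \<omega> p > 0"
  by (simp add: radius_def)

lemma radius_initial: "radius c \<omega> \<omega> = 1"
  by (simp add: radius_def)

lemma clock_initial: "clock c \<omega> \<omega> = 0"
  by (simp add: clock_def)

lemma DERIV_clock:
  assumes c: "c \<noteq> 0"
  shows "(clock c \<omega> has_real_derivative radius c \<omega> p / c) (at p)"
proof -
  \<comment> \<open>Any compact interval containing \<omega> and having p in its interior would do;
    the margin 1 turns the derivative within the interval into a two-sided one.\<close>
  let ?a = "min \<omega> p - 1" and ?b = "max \<omega> p + 1"
  have "((\<lambda>u. LBINT q=\<omega>..u. radius c \<omega> q / c) has_vector_derivative radius c \<omega> p / c)
      (at p within {?a..?b})"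
    unfolding radius_def using c by (intro interval_integral_FTC2 continuous_intros) auto
  then have "((\<lambda>u. LBINT q=\<omega>..u. radius c \<omega> q / c) has_vector_derivative radius c \<omega> p / c) (at p)"
    by (subst (asm) at_within_interior) auto
  then show ?thesis
    unfolding clock_def[abs_def] has_real_derivative_iff_has_vector_derivative .
qed

lemma isCont_clock: "c \<noteq> 0 \<Longrightarrow> isCont (clock c \<omega>) p"
  using DERIV_clock by (rule DERIV_isCont)

lemma strict_mono_clock:
  assumes "c > 0"
  shows "strict_mono (clock c \<omega>)"
proof (rule strict_monoI)
  fix p q :: real assume "p < q"
  then show "clock c \<omega> p < clock c \<omega> q"
    by (rule DERIV_pos_imp_increasing)
      (use assms radius_pos in \<open>blast intro: DERIV_clock divide_pos_pos less_imp_neq[symmetric]\<close>)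
qed

lemma strict_antimono_clock:
  assumes "c < 0" and "p < q"
  shows "clock c \<omega> q < clock c \<omega> p"
  by (rule DERIV_neg_imp_decreasing[OF assms(2)])
    (use assms radius_pos in \<open>blast intro: DERIV_clock divide_pos_neg less_imp_neq\<close>)

lemma inj_clock:
  assumes "c \<noteq> 0"
  shows "inj (clock c \<omega>)"
proof (cases "c > 0")
  case True
  then show ?thesis using strict_mono_clock strict_mono_imp_inj_on by blast
next
  case False
  then have "c < 0" using assms by simp
  then show ?thesis
    by (intro injI) (metis less_irrefl linorder_neqE_linordered_idom strict_antimono_clock)
qed

lemma slope_clock: "c \<noteq> 0 \<Longrightarrow> slope c \<omega> (clock c \<omega> p) = p"
  unfolding slope_def using inj_clock by simp

lemma clock_slope: "t \<in> range (clock c \<omega>) \<Longrightarrow> clock c \<omega> (slope c \<omega> t) = t"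
  unfolding slope_def by (rule f_inv_into_f)

lemma slope_initial: "c \<noteq> 0 \<Longrightarrow> slope c \<omega> 0 = \<omega>"
  using slope_clock[of c \<omega> \<omega>] by (simp add: clock_initial)

lemma DERIV_slope:
  assumes c: "c \<noteq> 0" and t: "t \<in> range (clock c \<omega>)"
  shows "(slope c \<omega> has_real_derivative c / radius c \<omega> (slope c \<omega> t)) (at t)"
proof -
  obtain p where p: "t = clock c \<omega> p" using t by auto
  have "(slope c \<omega> has_derivative (*) (c / radius c \<omega> p)) (at (clock c \<omega> p))"
  proof (rule has_derivative_inverse_strong[where f = "clock c \<omega>", OF open_UNIV UNIV_I])
    show "continuous_on UNIV (clock c \<omega>)"
      using isCont_clock[OF c] by (simp add: continuous_at_imp_continuous_on)
    show "(clock c \<omega> has_derivative (*) (radius c \<omega> p / c)) (at p)"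
      using DERIV_clock[OF c] unfolding has_field_derivative_def .
    show "(*) (radius c \<omega> p / c) \<circ> (*) (c / radius c \<omega> p) = id"
      using c radius_pos[of c \<omega> p] by (auto simp: fun_eq_iff)
  qed (rule slope_clock[OF c])
  then show ?thesis using c by (simp add: p slope_clock has_field_derivative_def)
qed

text \<open>The \<open>n\<close>-th derivative of \<open>t \<mapsto> radius (slope t)\<close> is
  \<open>radius (slope t)\<^bsup>1-n\<^esup>\<close> times the polynomial \<open>radius_poly n\<close> in \<open>slope t\<close>.\<close>

fun radius_poly :: "real \<Rightarrow> nat \<Rightarrow> real poly" where
  "radius_poly c 0 = 1"
| "radius_poly c (Suc n) =
     smult (1 - real n) (pCons 0 (radius_poly c n)) + smult c (pderiv (radius_poly c n))"

definition radius_deriv :: "real \<Rightarrow> real \<Rightarrow> nat \<Rightarrow> real \<Rightarrow> real" where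
  "radius_deriv c \<omega> n p =
     exp ((1 - real n) * ((p\<^sup>2 - \<omega>\<^sup>2) / (2 * c))) * poly (radius_poly c n) p"

lemma radius_deriv_simps:
  "radius_deriv c \<omega> 0 p = radius c \<omega> p" "radius_deriv c \<omega> (Suc 0) p = p"
  by (simp_all add: radius_deriv_def radius_def pderiv_1)

text \<open>With e = (p^2 - \<omega>^2)/(2c), differentiating exp((1-n)e) P in p gives exp((1-n)e)
  ((1-n) p P/c + P'). The chain rule multiplies this by the derivative c exp(-e) of
  \<open>slope\<close>, which lowers the exponent by one and yields the recursion of
  \<open>radius_poly\<close>.\<close>

lemma DERIV_radius_deriv:
  assumes c: "c \<noteq> 0" and t: "t \<in> range (clock c \<omega>)"
  shows "((\<lambda>t. radius_deriv c \<omega> n (slope c \<omega> t)) has_real_derivative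
           radius_deriv c \<omega> (Suc n) (slope c \<omega> t)) (at t)"
proof -
  define p where "p = slope c \<omega> t"
  define e where "e = (p\<^sup>2 - \<omega>\<^sup>2) / (2 * c)"
  have exp_split: "exp ((1 - real n) * e) = exp ((1 - real (Suc n)) * e) * exp e"
    by (simp add: exp_add[symmetric] algebra_simps)
  have "((\<lambda>p. exp ((1 - real n) * ((p\<^sup>2 - \<omega>\<^sup>2) / (2 * c)))) has_real_derivative
      exp ((1 - real n) * e) * ((1 - real n) * (p / c))) (at p)"
    using c by (auto intro!: derivative_eq_intros simp: e_def)
  from DERIV_mult[OF this poly_DERIV[of "radius_poly c n" p]]
  have "((\<lambda>p. radius_deriv c \<omega> n p) has_real_derivative
      exp ((1 - real n) * e) * ((1 - real n) * (p / c)) * poly (radius_poly c n) p +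
      poly (pderiv (radius_poly c n)) p * exp ((1 - real n) * e)) (at p)"
    unfolding radius_deriv_def e_def .
  also have "exp ((1 - real n) * e) * ((1 - real n) * (p / c)) * poly (radius_poly c n) p +
      poly (pderiv (radius_poly c n)) p * exp ((1 - real n) * e) =
      radius_deriv c \<omega> (Suc n) p * (radius c \<omega> p / c)"
    unfolding radius_deriv_def radius_def e_def[symmetric] exp_split
    using c by (simp add: divide_simps) (simp add: algebra_simps)
  finally have "((\<lambda>p. radius_deriv c \<omega> n p) has_real_derivative
      radius_deriv c \<omega> (Suc n) p * (radius c \<omega> p / c)) (at p)" .
  from DERIV_chain2[OF this[unfolded p_def] DERIV_slope[OF c t]] show ?thesis
    using c radius_pos[of c \<omega> p] by (simp add: p_def)
qed

section \<open>Smoothness, existence, uniqueness and maximality of the solution\<close>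

lemma Ck_on_radius_slope:
  assumes c: "c \<noteq> 0" and J: "J \<subseteq> range (clock c \<omega>)"
  shows "Ck_on k J (\<lambda>t. radius c \<omega> (slope c \<omega> t))"
proof -
  let ?D = "\<lambda>n t. radius_deriv c \<omega> n (slope c \<omega> t)"
  have D: "(?D n has_real_derivative ?D (Suc n) t) (at t within J)" if "t \<in> J" for n t
    using DERIV_radius_deriv[OF c] J that by (blast intro: has_field_derivative_at_within)
  moreover have "continuous_on J (?D n)" for n
    using D by (meson DERIV_continuous continuous_on_eq_continuous_within)
  ultimately show ?thesis
    unfolding Ck_on_def by (intro exI[of _ ?D]) (auto simp: radius_deriv_simps)
qed

text \<open>The case n = 0: the first polynomial is the identity and its exponential factor is
  1.\<close>

lemma DERIV_radius_slope:
  assumes "c \<noteq> 0" "t \<in> range (clock c \<omega>)"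
  shows "((\<lambda>t. radius c \<omega> (slope c \<omega> t)) has_real_derivative slope c \<omega> t) (at t)"
  using DERIV_radius_deriv[OF assms, of 0] by (simp add: radius_deriv_simps del: radius_poly.simps)

lemma deriv_within_radius_slope:
  assumes "c \<noteq> 0" "upto_time T \<subseteq> range (clock c \<omega>)" "t \<in> upto_time T"
  shows "deriv_within (upto_time T) (\<lambda>t. radius c \<omega> (slope c \<omega> t)) t = slope c \<omega> t"
  using DERIV_radius_slope assms
  by (blast intro: deriv_within_upto_time has_field_derivative_at_within)

lemma gamma_solution_radius_slope:
  assumes c: "2 * lam * \<sigma> \<noteq> 0" and T: "0 < T" "upto_time T \<subseteq> range (clock (2 * lam * \<sigma>) \<omega>)"
  shows "gamma_solution lam \<sigma> \<omega> T (\<lambda>t. radius (2 * lam * \<sigma>) \<omega> (slope (2 * lam * \<sigma>) \<omega> t))"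
    (is "gamma_solution _ _ _ _ ?\<gamma>")
proof -
  let ?J = "upto_time T" and ?p = "slope (2 * lam * \<sigma>) \<omega>"
  note dw = deriv_within_radius_slope[OF c T(2)]
  have "deriv_within ?J (deriv_within ?J ?\<gamma>) t = 2 * lam * \<sigma> / ?\<gamma> t" if t: "t \<in> ?J" for t
  proof (rule deriv_within_upto_time[OF t])
    have "(?p has_real_derivative 2 * lam * \<sigma> / ?\<gamma> t) (at t within ?J)"
      using DERIV_slope[OF c] T(2) t by (blast intro: has_field_derivative_at_within)
    then show "(deriv_within ?J ?\<gamma> has_real_derivative 2 * lam * \<sigma> / ?\<gamma> t) (at t within ?J)"
      by (rule has_real_derivative_cong_on[OF _ t]) (simp add: dw)
  qed
  then show ?thesis
    unfolding gamma_solution_def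
    using Ck_on_radius_slope[OF c T(2)] dw[OF zero_in_upto_time[OF T(1)]] radius_pos
    by (simp add: slope_initial[OF c] radius_initial less_imp_neq[symmetric])
qed

text \<open>By conservation of energy \<gamma> is \<open>radius\<close> of \<gamma>', so
  \<open>clock\<close> of \<gamma>' has time derivative (radius/c)(c/\<gamma>) = 1. It vanishes at
  time 0, hence equals t, and injectivity of \<open>clock\<close> determines \<gamma>'.\<close>

lemma gamma_solution_unique:
  assumes c: "2 * lam * \<sigma> \<noteq> 0" and T: "0 < T" and sol: "gamma_solution lam \<sigma> \<omega> T \<gamma>"
    and t: "t \<in> upto_time T"
  shows "t \<in> range (clock (2 * lam * \<sigma>) \<omega>)"
    and "\<gamma> t = radius (2 * lam * \<sigma>) \<omega> (slope (2 * lam * \<sigma>) \<omega> t)"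
proof -
  let ?c = "2 * lam * \<sigma>" and ?p = "deriv_within (upto_time T) \<gamma>"
  have \<gamma>: "\<gamma> t = radius ?c \<omega> (?p t)" if "t \<in> upto_time T" for t
    using gamma_solution_energy[OF T sol that] c by (simp add: radius_def)
  have "((\<lambda>t. clock ?c \<omega> (?p t) - t) has_real_derivative 0) (at t within upto_time T)"
    if t: "t \<in> upto_time T" for t
  proof -
    have "((\<lambda>t. clock ?c \<omega> (?p t) - t) has_real_derivative
        radius ?c \<omega> (?p t) / ?c * (?c / \<gamma> t) - 1) (at t within upto_time T)"
      by (intro derivative_intros DERIV_chain2[OF DERIV_clock[OF c]]
          gamma_solution_derivs[OF T sol t])
    then show ?thesis
      using c radius_pos[of ?c \<omega> "?p t"] by (simp add: \<gamma>[OF t])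
  qed
  then obtain C where C: "\<forall>t\<in>upto_time T. clock ?c \<omega> (?p t) - t = C"
    using has_field_derivative_zero_constant[OF convex_upto_time, of T "\<lambda>t. clock ?c \<omega> (?p t) - t"]
    by auto
  have "clock ?c \<omega> (?p t) = t"
    using bspec[OF C t] bspec[OF C zero_in_upto_time[OF T]]
      gamma_solution_initial[OF T sol] clock_initial
    by simp
  then show "t \<in> range (clock ?c \<omega>)" "\<gamma> t = radius ?c \<omega> (slope ?c \<omega> t)"
    using \<gamma>[OF t] slope_clock[OF c, of \<omega> "?p t"] by (metis rangeI, simp)
qed

text \<open>A solution living beyond T would be defined at time T, which uniqueness would make a
  value of \<open>clock\<close>; the strict bound rules this out.\<close>

lemma maximal_gamma_solution_radius_slope:
  assumes c: "2 * lam * \<sigma> \<noteq> 0" and T: "0 < T" "upto_time T \<subseteq> range (clock (2 * lam * \<sigma>) \<omega>)"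
    and bounded: "\<And>p. ereal (clock (2 * lam * \<sigma>) \<omega> p) < T"
  shows "maximal_gamma_solution lam \<sigma> \<omega> T
    (\<lambda>t. radius (2 * lam * \<sigma>) \<omega> (slope (2 * lam * \<sigma>) \<omega> t))"
  unfolding maximal_gamma_solution_def
proof (rule conjI[OF T(1) conjI[OF gamma_solution_radius_slope[OF c T]]], intro allI impI)
  fix T' \<eta> assume "0 < T' \<and> gamma_solution lam \<sigma> \<omega> T' \<eta>"
  then have T': "0 < T'" and \<eta>: "gamma_solution lam \<sigma> \<omega> T' \<eta>" by auto
  note unique = gamma_solution_unique[OF c T' \<eta>]
  have "T' \<le> T"
  proof (rule ccontr)
    assume "\<not> T' \<le> T"
    then have "T < T'" by simp
    then obtain s where s: "T = ereal s" using T(1) by (cases T) auto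
    then have "s \<in> upto_time T'"
      using \<open>T < T'\<close> T(1) by (simp add: upto_time_def)
    from unique(1)[OF this] show False
      using bounded s by auto
  qed
  then show "T' \<le> T \<and> (\<forall>t\<in>upto_time T'.
      \<eta> t = radius (2 * lam * \<sigma>) \<omega> (slope (2 * lam * \<sigma>) \<omega> t))"
    using unique(2) by blast
qed

section \<open>Time of existence and asymptotics\<close>

lemma between_range_clock:
  assumes c: "c \<noteq> 0" and le: "clock c \<omega> p \<le> t" "t \<le> clock c \<omega> q"
  shows "t \<in> range (clock c \<omega>)"
proof -
  have "connected (range (clock c \<omega>))"
    using isCont_clock[OF c]
    by (intro connected_continuous_image continuous_at_imp_continuous_on) auto
  from connectedD_interval[OF this rangeI rangeI le] show ?thesis .
qed

section \<open>Negative c: bounded clock and finite time of existence\<close>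

lemma clock_bounded:
  assumes c: "c < 0"
  shows "\<exists>M. \<forall>p. clock c \<omega> p \<le> M"
proof -
  \<comment> \<open>The constants are chosen so that \<open>radius\<close> becomes the Gaussian B
    exp(-(p/s)^2).\<close>
  define k where "k = - c"
  define s where "s = sqrt (2 * k)"
  define B where "B = exp (\<omega>\<^sup>2 / (2 * k))"
  have k: "k > 0" "c = - k" and s: "s > 0" "s\<^sup>2 = 2 * k" and B: "B > 0"
    using c by (auto simp: k_def s_def B_def)
  \<comment> \<open>The inequality 1 + u \<le> exp u replaces the Gaussian by a rational function
    whose primitive is an arctangent.\<close>
  have le: "radius c \<omega> p \<le> B / (1 + (p / s)\<^sup>2)" for p
  proof -
    have "(p\<^sup>2 - \<omega>\<^sup>2) / (2 * c) = \<omega>\<^sup>2 / (2 * k) - (p / s)\<^sup>2"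
      using k s by (simp add: power_divide field_simps)
    then have "radius c \<omega> p = B / exp ((p / s)\<^sup>2)"
      by (simp add: radius_def B_def exp_diff)
    also have "\<dots> \<le> B / (1 + (p / s)\<^sup>2)"
      using B by (intro divide_left_mono) (auto intro!: mult_pos_pos add_pos_nonneg)
    finally show ?thesis .
  qed
  \<comment> \<open>The first term of \<open>h\<close> has derivative -radius, the second that of
    the rational majorant; so \<open>h\<close> is nondecreasing, which compares \<open>clock\<close>
    with the bounded arctangent.\<close>
  define h where "h p = k * clock c \<omega> p + s * B * arctan (p / s)" for p
  have deriv_h: "(h has_real_derivative k * (radius c \<omega> p / c) +
      s * B * (inverse (1 + (p / s)\<^sup>2) * (1 / s))) (at p)" for p
    unfolding h_def using s c
    by (intro DERIV_add DERIV_cmult DERIV_clock DERIV_chain2[OF DERIV_arctan]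
        DERIV_cdivide DERIV_ident) auto
  have deriv_eq: "k * (radius c \<omega> p / c) + s * B * (inverse (1 + (p / s)\<^sup>2) * (1 / s)) =
      B / (1 + (p / s)\<^sup>2) - radius c \<omega> p" for p
  proof -
    have "s * B * (x * (1 / s)) = B * x" "k * (x / c) = - x" for x
      using k s by simp_all
    then show ?thesis by (simp only: divide_inverse[of B])
  qed
  have dh: "\<exists>y. (h has_real_derivative y) (at p) \<and> 0 \<le> y" for p
  proof (intro exI conjI)
    show "(h has_real_derivative B / (1 + (p / s)\<^sup>2) - radius c \<omega> p) (at p)"
      by (rule DERIV_cong[OF deriv_h deriv_eq])
    show "0 \<le> B / (1 + (p / s)\<^sup>2) - radius c \<omega> p"
      using le[of p] by (rule diff_ge_0_iff_ge[THEN iffD2])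
  qed
  have "clock c \<omega> p \<le> s * B * pi / k" for p
  proof (cases "p \<le> \<omega>")
    case True
    have "h p \<le> h \<omega>"
      by (rule DERIV_nonneg_imp_nondecreasing[OF True dh])
    then have "k * clock c \<omega> p \<le> s * B * (arctan (\<omega> / s) - arctan (p / s))"
      by (simp add: h_def clock_initial algebra_simps)
    also have "\<dots> \<le> s * B * pi"
      using s B arctan_ubound[of "\<omega> / s"] arctan_lbound[of "p / s"]
      by (intro mult_left_mono) auto
    finally show ?thesis
      using k by (simp add: field_simps)
  next
    \<comment> \<open>To the right of \<omega> the clock is negative, since it decreases from the
      value 0 at \<omega>.\<close>
    case False
    then have "clock c \<omega> p \<le> 0"
      using strict_antimono_clock[OF c, of \<omega> p \<omega>] by (simp add: clock_initial)
    also have "0 \<le> s * B * pi / k"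
      using s B k by simp
    finally show ?thesis .
  qed
  then show ?thesis by blast
qed

lemma finite_time_maximal_gamma_solution:
  assumes c: "2 * lam * \<sigma> < 0"
  shows "\<exists>T \<gamma>. maximal_gamma_solution lam \<sigma> \<omega> T \<gamma> \<and> T < \<infinity>"
proof -
  let ?c = "2 * lam * \<sigma>"
  define S where "S = Sup (range (clock ?c \<omega>))"
  have c0: "?c \<noteq> 0" using c by (rule less_imp_neq)
  have bdd: "bdd_above (range (clock ?c \<omega>))"
    using clock_bounded[OF c, of \<omega>] by (auto simp: bdd_above_def)
  \<comment> \<open>The supremum is not attained: moving p to the left increases the clock strictly.
    So time S itself is never reached.\<close>
  have lt: "clock ?c \<omega> p < S" for p
  proof -
    have "clock ?c \<omega> p < clock ?c \<omega> (p - 1)"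
      by (rule strict_antimono_clock[OF c]) simp
    also have "\<dots> \<le> S"
      unfolding S_def by (rule cSup_upper[OF rangeI bdd])
    finally show ?thesis .
  qed
  have "upto_time (ereal S) \<subseteq> range (clock ?c \<omega>)"
  proof
    fix t assume "t \<in> upto_time (ereal S)"
    then have t: "0 \<le> t" "t < S" by (auto simp: upto_time_def)
    then obtain q where "t < clock ?c \<omega> q"
      using less_cSup_iff[of "range (clock ?c \<omega>)" t] bdd by (auto simp: S_def)
    then show "t \<in> range (clock ?c \<omega>)"
      using between_range_clock[OF c0, of \<omega> \<omega> t q] t by (simp add: clock_initial)
  qed
  moreover have "0 < ereal S"
    using lt[of \<omega>] by (simp add: clock_initial zero_ereal_def)
  ultimately have "maximal_gamma_solution lam \<sigma> \<omega> (ereal S) (\<lambda>t. radius ?c \<omega> (slope ?c \<omega> t))"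
    using lt by (intro maximal_gamma_solution_radius_slope[OF c0]) auto
  then show ?thesis by force
qed

section \<open>Positive c: global existence and asymptotics\<close>

context
  fixes c \<omega> :: real
  assumes c: "c > 0"
begin

lemma c_nonzero: "c \<noteq> 0" using c by simp

text \<open>\<open>radius\<close> is bounded below by its value at 0, so the derivative of
  \<open>clock\<close> is at least d > 0 and the clock grows at least linearly in both
  directions.\<close>

lemma clock_surj: "range (clock c \<omega>) = UNIV"
proof -
  define d where "d = exp (- \<omega>\<^sup>2 / (2 * c)) / c"
  have d: "d > 0" using c by (simp add: d_def)
  have "d \<le> radius c \<omega> p / c" for p
  proof -
    have "- \<omega>\<^sup>2 / (2 * c) \<le> (p\<^sup>2 - \<omega>\<^sup>2) / (2 * c)"
      using c by (intro divide_right_mono) auto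
    then show ?thesis
      unfolding d_def radius_def using c by (intro divide_right_mono) auto
  qed
  then have ge: "0 \<le> radius c \<omega> p / c - d * 1" for p
    by simp
  have dh: "\<exists>y. ((\<lambda>p. clock c \<omega> p - d * p) has_real_derivative y) (at p) \<and> 0 \<le> y" for p
    using DERIV_diff[OF DERIV_clock[OF c_nonzero] DERIV_cmult[OF DERIV_ident]] ge by blast
  have mono: "clock c \<omega> p - d * p \<le> clock c \<omega> q - d * q" if "p \<le> q" for p q
    by (rule DERIV_nonneg_imp_nondecreasing[OF that dh])
  have "t \<in> range (clock c \<omega>)" for t
  proof (rule between_range_clock[OF c_nonzero])
    \<comment> \<open>At distance \<bar>t\<bar>/d from \<omega> the linear bound already reaches
      \<bar>t\<bar> in absolute value.\<close>
    show "clock c \<omega> (\<omega> - \<bar>t\<bar> / d) \<le> t"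
      using mono[of "\<omega> - \<bar>t\<bar> / d" \<omega>] d by (simp add: clock_initial right_diff_distrib)
    show "t \<le> clock c \<omega> (\<omega> + \<bar>t\<bar> / d)"
      using mono[of \<omega> "\<omega> + \<bar>t\<bar> / d"] d by (simp add: clock_initial distrib_left)
  qed
  then show ?thesis by blast
qed

lemma clock_slope': "clock c \<omega> (slope c \<omega> t) = t"
  by (rule clock_slope) (simp add: clock_surj)

lemma slope_at_top: "filterlim (slope c \<omega>) at_top at_top"
  unfolding filterlim_at_top
proof
  fix Z
  have "Z \<le> slope c \<omega> t" if "clock c \<omega> Z \<le> t" for t
    using that strict_mono_less_eq[OF strict_mono_clock[OF c], of \<omega> Z "slope c \<omega> t"]
    by (simp add: clock_slope')
  then show "eventually (\<lambda>t. Z \<le> slope c \<omega> t) at_top"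
    using eventually_ge_at_top[of "clock c \<omega> Z"] by (rule eventually_mono[rotated])
qed

text \<open>L'Hospital's rule: the derivative of \<open>radius p / p\<close> is radius (1/c -
  1/p^2), that of \<open>clock\<close> is radius/c, and the factor \<open>radius\<close> cancels in
  the quotient.\<close>

lemma clock_asymptotics: "((\<lambda>p. clock c \<omega> p / (radius c \<omega> p / p)) \<longlongrightarrow> 1) at_top"
proof (rule lhospital_at_top_at_top)
  let ?g' = "\<lambda>p. radius c \<omega> p * (1 / c - 1 / p\<^sup>2)"
  show "filterlim (\<lambda>p. radius c \<omega> p / p) at_top at_top"
    unfolding radius_def using c by real_asymp
  have ev: "\<forall>\<^sub>F p in at_top. 1 / c - 1 / p\<^sup>2 > 0"
    using c by real_asymp
  have "?g' p > 0" if "1 / c - 1 / p\<^sup>2 > 0" for p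
    using radius_pos that by (rule mult_pos_pos)
  then have "?g' p \<noteq> 0" if "1 / c - 1 / p\<^sup>2 > 0" for p
    using that by (simp only: less_imp_neq[symmetric] not_False_eq_True)
  with ev show "\<forall>\<^sub>F p in at_top. ?g' p \<noteq> 0"
    by (rule eventually_mono)
  show "\<forall>\<^sub>F p in at_top. (clock c \<omega> has_real_derivative radius c \<omega> p / c) (at p)"
    using DERIV_clock[OF c_nonzero] by simp
  show "\<forall>\<^sub>F p in at_top. ((\<lambda>p. radius c \<omega> p / p) has_real_derivative ?g' p) (at p)"
    using eventually_gt_at_top[of 0]
  proof eventually_elim
    case (elim p)
    have "(radius c \<omega> has_real_derivative radius c \<omega> p * (p / c)) (at p)"
      unfolding radius_def[abs_def] using c by (auto intro!: derivative_eq_intros)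
    from DERIV_divide[OF this DERIV_ident] show ?case
      using elim c by (auto elim!: DERIV_cong simp: field_simps power2_eq_square)
  qed
  have "((\<lambda>p. (1 / c) / (1 / c - 1 / p\<^sup>2)) \<longlongrightarrow> 1) at_top"
    using c by real_asymp
  then show "((\<lambda>p. radius c \<omega> p / c / ?g' p) \<longlongrightarrow> 1) at_top"
    using radius_pos[of c \<omega>] by (simp add: less_imp_neq[symmetric])
qed

text \<open>Taking logarithms in clock = R radius / p with R tending to 1, the term p^2/(2c) from
  \<open>ln radius\<close> dominates ln p and the constants.\<close>

lemma ln_clock_asymptotics: "((\<lambda>p. ln (clock c \<omega> p) / (p\<^sup>2 / (2 * c))) \<longlongrightarrow> 1) at_top"
proof -
  define R where "R p = clock c \<omega> p / (radius c \<omega> p / p)" for p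
  have R: "(R \<longlongrightarrow> 1) at_top"
    using clock_asymptotics unfolding R_def .
  have "((\<lambda>p. ln (R p)) \<longlongrightarrow> 0) at_top"
    using tendsto_ln[OF R] by simp
  moreover have "((\<lambda>p. 2 * c / p\<^sup>2) \<longlongrightarrow> 0) at_top"
    using c by real_asymp
  ultimately have "((\<lambda>p. ln (R p) * (2 * c / p\<^sup>2)) \<longlongrightarrow> 0) at_top"
    using tendsto_mult_zero by blast
  moreover have "((\<lambda>p. ((p\<^sup>2 - \<omega>\<^sup>2) / (2 * c) - ln p) / (p\<^sup>2 / (2 * c))) \<longlongrightarrow> 1) at_top"
    using c by real_asymp
  ultimately have lim: "((\<lambda>p. ln (R p) * (2 * c / p\<^sup>2) +
      ((p\<^sup>2 - \<omega>\<^sup>2) / (2 * c) - ln p) / (p\<^sup>2 / (2 * c))) \<longlongrightarrow> 0 + 1) at_top"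
    by (rule tendsto_add)
  have "\<forall>\<^sub>F p in at_top. R p > 0"
    using R order_tendstoD(1)[of R 1 at_top 0] by simp
  then have "\<forall>\<^sub>F p in at_top. ln (R p) * (2 * c / p\<^sup>2) +
      ((p\<^sup>2 - \<omega>\<^sup>2) / (2 * c) - ln p) / (p\<^sup>2 / (2 * c)) = ln (clock c \<omega> p) / (p\<^sup>2 / (2 * c))"
    using eventually_gt_at_top[of 0]
  proof eventually_elim
    case (elim p)
    have "clock c \<omega> p = R p * (radius c \<omega> p / p)"
      using elim radius_pos[of c \<omega> p] by (simp add: R_def)
    then have "ln (clock c \<omega> p) = ln (R p) + ((p\<^sup>2 - \<omega>\<^sup>2) / (2 * c) - ln p)"
      using elim radius_pos[of c \<omega> p] by (simp add: ln_mult ln_div radius_def)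
    then show ?case
      by (simp add: add_divide_distrib ring_distribs)
  qed
  with lim show ?thesis
    by (simp add: filterlim_cong[OF refl refl])
qed

text \<open>Substituting p = \<open>slope t\<close> turns the clock into t, so ln t is equivalent to
  slope^2/(2c); then take square roots.\<close>

lemma slope_asymptotics: "slope c \<omega> \<sim>[at_top] (\<lambda>t. sqrt (2 * c * ln t))"
proof -
  have "((\<lambda>t. ln t / ((slope c \<omega> t)\<^sup>2 / (2 * c))) \<longlongrightarrow> 1) at_top"
    using filterlim_compose[OF ln_clock_asymptotics slope_at_top] by (simp add: clock_slope')
  then have "((\<lambda>t. 1 / sqrt (ln t / ((slope c \<omega> t)\<^sup>2 / (2 * c)))) \<longlongrightarrow> 1 / sqrt 1) at_top"
    by (intro tendsto_intros) auto
  moreover have "\<forall>\<^sub>F t in at_top. 1 / sqrt (ln t / ((slope c \<omega> t)\<^sup>2 / (2 * c))) =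
      slope c \<omega> t / sqrt (2 * c * ln t)"
    \<comment> \<open>Eventual positivity of the slope removes the absolute value from the root of
      its square.\<close>
    using filterlim_at_top_dense[THEN iffD1, OF slope_at_top, rule_format, of 0]
  proof eventually_elim
    case (elim t)
    have "ln t / ((slope c \<omega> t)\<^sup>2 / (2 * c)) = 2 * c * ln t / (slope c \<omega> t)\<^sup>2"
      by simp
    then show ?case
      using elim by (simp only: real_sqrt_divide real_sqrt_abs) simp
  qed
  ultimately show ?thesis
    by (intro asymp_equivI') (simp add: filterlim_cong[OF refl refl])
qed

lemma radius_slope_asymptotics:
  "(\<lambda>t. radius c \<omega> (slope c \<omega> t)) \<sim>[at_top] (\<lambda>t. t * sqrt (2 * c * ln t))"
proof -
  have "((\<lambda>t. t / (radius c \<omega> (slope c \<omega> t) / slope c \<omega> t)) \<longlongrightarrow> 1) at_top"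
    using filterlim_compose[OF clock_asymptotics slope_at_top] by (simp add: clock_slope')
  then have "(\<lambda>t. t * slope c \<omega> t) \<sim>[at_top] (\<lambda>t. radius c \<omega> (slope c \<omega> t))"
    by (intro asymp_equivI') simp
  then have "(\<lambda>t. radius c \<omega> (slope c \<omega> t)) \<sim>[at_top] (\<lambda>t. t * slope c \<omega> t)"
    by (rule asymp_equiv_symI)
  also have "\<dots> \<sim>[at_top] (\<lambda>t. t * sqrt (2 * c * ln t))"
    by (intro asymp_equiv_mult asymp_equiv_refl slope_asymptotics)
  finally show ?thesis .
qed

end

lemma global_gamma_solution:
  assumes c: "lam * \<sigma> > 0"
  shows "\<exists>\<gamma>. maximal_gamma_solution lam \<sigma> \<omega> \<infinity> \<gamma> \<and> smooth_on {0..} \<gamma> \<and>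
           (\<forall>T>0. gamma_solution lam \<sigma> \<omega> T \<gamma>) \<and>
           \<gamma> \<sim>[at_top] (\<lambda>t. 2 * t * sqrt (lam * \<sigma> * ln t)) \<and>
           deriv_within {0..} \<gamma> \<sim>[at_top] (\<lambda>t. 2 * sqrt (lam * \<sigma> * ln t))"
proof -
  let ?c = "2 * lam * \<sigma>"
  let ?\<gamma> = "\<lambda>t. radius ?c \<omega> (slope ?c \<omega> t)"
  have c0: "?c > 0" using c by (simp only: mult.assoc)
  then have c0': "?c \<noteq> 0" by (rule less_imp_neq[symmetric])
  have range: "J \<subseteq> range (clock ?c \<omega>)" for J
    using clock_surj[OF c0] by simp
  \<comment> \<open>Here 2c = 4 lam \<sigma>, which is the source of the factor 2 in both asymptotic
    formulas.\<close>
  have sqrt: "sqrt (2 * ?c * ln t) = 2 * sqrt (lam * \<sigma> * ln t)" for t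
    using real_sqrt_mult[of 4 "lam * \<sigma> * ln t"] by (simp add: mult.assoc)
  have "maximal_gamma_solution lam \<sigma> \<omega> \<infinity> ?\<gamma>"
    by (intro maximal_gamma_solution_radius_slope[OF c0'] range) auto
  moreover have "smooth_on {0..} ?\<gamma>"
    unfolding smooth_on_def using Ck_on_radius_slope[OF c0' range] by blast
  moreover have "\<forall>T>0. gamma_solution lam \<sigma> \<omega> T ?\<gamma>"
    using gamma_solution_radius_slope[OF c0' _ range] by blast
  moreover have "?\<gamma> \<sim>[at_top] (\<lambda>t. 2 * t * sqrt (lam * \<sigma> * ln t))"
    using radius_slope_asymptotics[OF c0, of \<omega>] unfolding sqrt by (simp only: mult_ac)
  moreover have "deriv_within {0..} ?\<gamma> \<sim>[at_top] (\<lambda>t. 2 * sqrt (lam * \<sigma> * ln t))"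
  proof -
    \<comment> \<open>The derivative within [0,\<infinity>[ is controlled only for nonnegative t;
      eventual equality is enough.\<close>
    have "\<forall>\<^sub>F t in at_top. deriv_within {0..} ?\<gamma> t = slope ?c \<omega> t"
      using eventually_ge_at_top[of 0]
    proof eventually_elim
      case (elim t)
      then show ?case
        using deriv_within_radius_slope[OF c0' range, of t \<infinity>] by (simp add: upto_time_PInf)
    qed
    then have "deriv_within {0..} ?\<gamma> \<sim>[at_top] slope ?c \<omega>"
      by (rule asymp_equiv_refl_ev)
    from asymp_equiv_trans[OF this slope_asymptotics[OF c0]] show ?thesis
      unfolding sqrt .
  qed
  ultimately show ?thesis by (intro exI[of _ ?\<gamma>]) simp
qed

section \<open>The Vlasov equation\<close>

lemma C1_on_prodI:
  fixes f a b :: "real \<times> real \<Rightarrow> real"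
  assumes "\<And>q. q \<in> S \<Longrightarrow> (f has_derivative (\<lambda>h. a q * fst h + b q * snd h)) (at q within S)"
    and "continuous_on S a" "continuous_on S b"
  shows "C1_on S f"
  unfolding C1_on_def
proof (intro exI conjI ballI)
  \<comment> \<open>Writing the derivative as a combination of the two projections reduces
    continuity in operator norm to that of the scalar coefficients.\<close>
  let ?f' = "\<lambda>q. a q *\<^sub>R fst_blinfun + b q *\<^sub>R snd_blinfun"
  show "continuous_on S ?f'"
    using assms(2,3) by (intro continuous_intros)
  fix q assume "q \<in> S"
  moreover have "blinfun_apply (?f' q) = (\<lambda>h. a q * fst h + b q * snd h)"
    by (auto simp: fun_eq_iff blinfun.bilinear_simps)
  ultimately show "(f has_derivative blinfun_apply (?f' q)) (at q within S)"
    using assms(1) by simp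
qed

lemma compact_subset_open_time_interval:
  fixes C :: "real set"
  assumes "compact C" "C \<subseteq> {t. 0 < t \<and> ereal t < T}" "0 < T"
  obtains a b where "0 < a" "a < b" "ereal b < T" "C \<subseteq> {a<..<b}"
proof (cases "C = {}")
  \<comment> \<open>This case arises from the zero test function; any subinterval serves.\<close>
  case True
  obtain b where "0 < ereal b" "ereal b < T"
    using ereal_dense2[OF assms(3)] by auto
  with True show ?thesis by (intro that[of "b / 2" b]) auto
next
  case False
  obtain l where l: "l \<in> C" "\<And>t. t \<in> C \<Longrightarrow> l \<le> t"
    using compact_attains_inf[OF assms(1) False] by blast
  obtain u where u: "u \<in> C" "\<And>t. t \<in> C \<Longrightarrow> t \<le> u"
    using compact_attains_sup[OF assms(1) False] by blast
  obtain b where b: "ereal u < ereal b" "ereal b < T"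
    using ereal_dense2[of "ereal u" T] u assms(2) by auto
  have l0: "0 < l" using l(1) assms(2) by auto
  have ub: "u < b" using b(1) by simp
  have "C \<subseteq> {l / 2<..<b}"
  proof
    fix t assume "t \<in> C"
    then have "l \<le> t" "t \<le> u" using l(2) u(2) by auto
    then show "t \<in> {l / 2<..<b}" using l0 ub by simp
  qed
  then show ?thesis
    using l0 ub l(2)[OF u(1)] b(2) by (intro that[of "l / 2" b]) simp_all
qed

text \<open>The complement of the closed support is open and \<alpha> is zero there, so one compact
  set K serves both \<alpha> and its derivative.\<close>

lemma test_function_derivative:
  assumes "test_function T \<alpha>"
  obtains \<alpha>' :: "real \<times> real \<times> real \<Rightarrow> (real \<times> real \<times> real) \<Rightarrow>\<^sub>L real" and K
  where "\<And>q. (\<alpha> has_derivative \<alpha>' q) (at q)" "continuous_on UNIV \<alpha>'"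
    "compact K" "K \<subseteq> {t. 0 < t \<and> ereal t < T} \<times> UNIV"
    "\<And>q. q \<notin> K \<Longrightarrow> \<alpha> q = 0" "\<And>q. q \<notin> K \<Longrightarrow> \<alpha>' q = 0"
proof -
  define K where "K = closure {q. \<alpha> q \<noteq> 0}"
  obtain \<alpha>' :: "real \<times> real \<times> real \<Rightarrow> (real \<times> real \<times> real) \<Rightarrow>\<^sub>L real" where
    \<alpha>': "\<forall>q. (\<alpha> has_derivative \<alpha>' q) (at q)" "continuous_on UNIV \<alpha>'"
    using assms unfolding test_function_def C1_on_def by auto
  have zero: "\<alpha> q = 0" if "q \<notin> K" for q
    using that closure_subset[of "{q. \<alpha> q \<noteq> 0}"] unfolding K_def by auto
  have zero': "\<alpha>' q = 0" if q: "q \<notin> K" for q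
  proof -
    have "(\<alpha> has_derivative (\<lambda>_. 0)) (at q)"
    proof (rule has_derivative_transform_within_open)
      show "open (- K)" "q \<in> - K" using q by (simp_all add: K_def open_Compl)
      show "0 = \<alpha> q'" if "q' \<in> - K" for q' using zero that by simp
    qed simp
    then have "blinfun_apply (\<alpha>' q) = (\<lambda>_. 0)"
      by (rule has_derivative_unique[OF spec[OF \<alpha>'(1)]])
    then show ?thesis by (intro blinfun_eqI) simp
  qed
  have "compact K" "K \<subseteq> {t. 0 < t \<and> ereal t < T} \<times> UNIV"
    using assms unfolding test_function_def K_def by blast+
  from that[OF spec[OF \<alpha>'(1)] \<alpha>'(2) this zero zero'] show ?thesis .
qed

lemma partial_derivs:
  fixes \<alpha> :: "real \<times> real \<times> real \<Rightarrow> real"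
  assumes "\<And>q. (\<alpha> has_derivative blinfun_apply (\<alpha>' q)) (at q)"
  shows "deriv (\<lambda>s. \<alpha> (s, x, \<xi>)) t = \<alpha>' (t, x, \<xi>) (1, 0, 0)"
    and "deriv (\<lambda>y. \<alpha> (t, y, \<xi>)) x = \<alpha>' (t, x, \<xi>) (0, 1, 0)"
    and "deriv (\<lambda>\<eta>. \<alpha> (t, x, \<eta>)) \<xi> = \<alpha>' (t, x, \<xi>) (0, 0, 1)"
proof -
  \<comment> \<open>Each partial derivative is a derivative along a coordinate line.\<close>
  have curve: "deriv (\<lambda>s. \<alpha> (c s)) s = \<alpha>' (c s) d" if "(c has_vector_derivative d) (at s)"
    for c :: "real \<Rightarrow> real \<times> real \<times> real" and d s
  proof (rule DERIV_imp_deriv)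
    have "((\<lambda>s. \<alpha> (c s)) has_derivative (\<lambda>h. \<alpha>' (c s) (h *\<^sub>R d))) (at s)"
      using that assms unfolding has_vector_derivative_def by (rule has_derivative_compose)
    then show "((\<lambda>s. \<alpha> (c s)) has_real_derivative \<alpha>' (c s) d) (at s)"
      by (simp add: has_field_derivative_def blinfun.scaleR_right mult.commute[of _ "\<alpha>' (c s) d"])
  qed
  show "deriv (\<lambda>s. \<alpha> (s, x, \<xi>)) t = \<alpha>' (t, x, \<xi>) (1, 0, 0)"
    by (rule curve)
      (auto intro!: derivative_eq_intros simp: has_vector_derivative_def zero_prod_def)
  show "deriv (\<lambda>y. \<alpha> (t, y, \<xi>)) x = \<alpha>' (t, x, \<xi>) (0, 1, 0)"
    by (rule curve)
      (auto intro!: derivative_eq_intros simp: has_vector_derivative_def zero_prod_def)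
  show "deriv (\<lambda>\<eta>. \<alpha> (t, x, \<eta>)) \<xi> = \<alpha>' (t, x, \<xi>) (0, 0, 1)"
    by (rule curve)
      (auto intro!: derivative_eq_intros simp: has_vector_derivative_def zero_prod_def)
qed

lemma distr_monokinetic_fst:
  assumes "v \<in> borel_measurable borel"
  shows "distr (monokinetic \<rho> v) borel fst = density lborel (\<lambda>x. ennreal (\<rho> x))"
proof -
  have "distr (monokinetic \<rho> v) borel fst =
      distr (density lborel (\<lambda>x. ennreal (\<rho> x))) borel (\<lambda>x. x)"
    unfolding monokinetic_def using assms
    by (subst distr_distr) (auto simp: comp_def borel_prod[symmetric])
  also have "\<dots> = density lborel (\<lambda>x. ennreal (\<rho> x))"
    by (rule distr_id2) simp
  finally show ?thesis .
qed

section \<open>The Gaussian solution, its characteristics and the weak formulation\<close>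

context
  fixes lam \<sigma> \<omega> \<rho>s p :: real and T :: ereal and \<gamma> :: "real \<Rightarrow> real"
  assumes T: "0 < T" and sol: "gamma_solution lam \<sigma> \<omega> T \<gamma>" and \<rho>s: "0 < \<rho>s"
begin

definition velocity :: "real \<Rightarrow> real \<Rightarrow> real" where
  "velocity t x = deriv_within (upto_time T) \<gamma> t / \<gamma> t * (x - p * t) + p"

definition gaussian :: "real \<Rightarrow> real \<Rightarrow> real" where
  "gaussian t x = \<rho>s / \<gamma> t * exp (- \<sigma> * (x - p * t)\<^sup>2 / (\<gamma> t)\<^sup>2)"

text \<open>The characteristic starting at \<open>(y, velocity 0 y)\<close>, parametrised by time.\<close>

definition flow :: "real \<Rightarrow> real \<Rightarrow> real \<times> real \<times> real" where
  "flow t y = (t, p * t + \<gamma> t * y, deriv_within (upto_time T) \<gamma> t * y + p)"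

text \<open>The time derivative of \<open>flow\<close>, with \<gamma>'' already replaced through the
  equation.\<close>

definition flow_velocity :: "real \<Rightarrow> real \<Rightarrow> real \<times> real \<times> real" where
  "flow_velocity t y = (1, deriv_within (upto_time T) \<gamma> t * y + p, 2 * lam * \<sigma> / \<gamma> t * y)"

lemma has_derivative_gamma_fst:
  assumes "q \<in> upto_time T \<times> UNIV"
  shows "((\<lambda>q. \<gamma> (fst q)) has_derivative
      (\<lambda>h. deriv_within (upto_time T) \<gamma> (fst q) * fst h)) (at q within upto_time T \<times> UNIV)"
    and "((\<lambda>q. deriv_within (upto_time T) \<gamma> (fst q)) has_derivative
      (\<lambda>h. 2 * lam * \<sigma> / \<gamma> (fst q) * fst h)) (at q within upto_time T \<times> UNIV)"
proof -
  have fst: "(fst has_derivative fst) (at q within upto_time T \<times> UNIV)"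
    "fst ` (upto_time T \<times> UNIV) \<subseteq> upto_time T"
    by (auto intro: derivative_intros)
  note d = gamma_solution_derivs[OF T sol, unfolded has_field_derivative_def]
  show "((\<lambda>q. \<gamma> (fst q)) has_derivative
      (\<lambda>h. deriv_within (upto_time T) \<gamma> (fst q) * fst h)) (at q within upto_time T \<times> UNIV)"
    by (rule has_derivative_in_compose2[OF d(1) fst(2) assms fst(1)])
  show "((\<lambda>q. deriv_within (upto_time T) \<gamma> (fst q)) has_derivative
      (\<lambda>h. 2 * lam * \<sigma> / \<gamma> (fst q) * fst h)) (at q within upto_time T \<times> UNIV)"
    by (rule has_derivative_in_compose2[OF d(2) fst(2) assms fst(1)])
qed

lemma continuous_on_gamma_fst:
  "continuous_on (upto_time T \<times> UNIV) (\<lambda>q. \<gamma> (fst q))"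
  "continuous_on (upto_time T \<times> UNIV) (\<lambda>q. deriv_within (upto_time T) \<gamma> (fst q))"
  by (intro continuous_on_compose2[OF gamma_solution_continuous(1)[OF T sol] continuous_on_fst]
      continuous_on_compose2[OF gamma_solution_continuous(2)[OF T sol] continuous_on_fst]
      continuous_on_id; auto)+

lemma gamma_nonzero: "t \<in> upto_time T \<Longrightarrow> \<gamma> t \<noteq> 0"
  using gamma_solution_pos[OF T sol] by (simp add: less_imp_neq[symmetric])

lemma C1_velocity: "C1_on (upto_time T \<times> UNIV) (\<lambda>(t, x). velocity t x)"
proof -
  let ?P = "\<lambda>q. deriv_within (upto_time T) \<gamma> (fst q)" and ?G = "\<lambda>q. \<gamma> (fst q)"
  \<comment> \<open>The coefficient of the first term is the quotient rule for \<gamma>'/\<gamma>,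
    where \<gamma>'' \<gamma> = 2 lam \<sigma>.\<close>
  let ?a = "\<lambda>q. (2 * lam * \<sigma> - (?P q)\<^sup>2) / (?G q)\<^sup>2 * (snd q - p * fst q) - ?P q / ?G q * p"
  have "C1_on (upto_time T \<times> UNIV) (\<lambda>q. ?P q / ?G q * (snd q - p * fst q) + p)"
  proof (rule C1_on_prodI[where a = ?a and b = "\<lambda>q. ?P q / ?G q"])
    fix q :: "real \<times> real" assume q: "q \<in> upto_time T \<times> UNIV"
    then have "?G q \<noteq> 0" using gamma_nonzero by auto
    then show "((\<lambda>q. ?P q / ?G q * (snd q - p * fst q) + p) has_derivative
        (\<lambda>h. ?a q * fst h + ?P q / ?G q * snd h)) (at q within upto_time T \<times> UNIV)"
      by (auto intro!: derivative_eq_intros has_derivative_gamma_fst[OF q]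
          simp: fun_eq_iff field_simps power2_eq_square)
  qed (auto intro!: continuous_intros continuous_on_gamma_fst simp: gamma_nonzero)
  then show ?thesis
    by (simp add: velocity_def case_prod_unfold)
qed

lemma C1_gaussian: "C1_on (upto_time T \<times> UNIV) (\<lambda>(t, x). gaussian t x)"
proof -
  let ?P = "\<lambda>q. deriv_within (upto_time T) \<gamma> (fst q)" and ?G = "\<lambda>q. \<gamma> (fst q)"
  let ?x = "\<lambda>q. snd q - p * fst q"
  let ?E = "\<lambda>q. exp (- \<sigma> * (?x q)\<^sup>2 / (?G q)\<^sup>2)"
  \<comment> \<open>The brackets in \<open>?a\<close> and \<open>?b\<close> are the time and space
    derivatives of the logarithm of the density.\<close>
  let ?a = "\<lambda>q. \<rho>s / ?G q * ?E q *
      (2 * \<sigma> * p * ?x q / (?G q)\<^sup>2 + 2 * \<sigma> * (?x q)\<^sup>2 * ?P q / (?G q)^3 - ?P q / ?G q)"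
  let ?b = "\<lambda>q. \<rho>s / ?G q * ?E q * (- 2 * \<sigma> * ?x q / (?G q)\<^sup>2)"
  have "C1_on (upto_time T \<times> UNIV) (\<lambda>q. \<rho>s / ?G q * ?E q)"
  proof (rule C1_on_prodI[where a = ?a and b = ?b])
    fix q :: "real \<times> real" assume q: "q \<in> upto_time T \<times> UNIV"
    then have G: "?G q \<noteq> 0" using gamma_nonzero by auto
    have "((\<lambda>q. - \<sigma> * (?x q)\<^sup>2 / (?G q)\<^sup>2) has_derivative
        (\<lambda>h. (2 * \<sigma> * p * ?x q / (?G q)\<^sup>2 + 2 * \<sigma> * (?x q)\<^sup>2 * ?P q / (?G q)^3) * fst h
          + (- 2 * \<sigma> * ?x q / (?G q)\<^sup>2) * snd h)) (at q within upto_time T \<times> UNIV)"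
      using G by (auto intro!: derivative_eq_intros has_derivative_gamma_fst[OF q]
          simp: fun_eq_iff field_simps power2_eq_square power3_eq_cube)
    note E = has_derivative_exp[OF this]
    have "((\<lambda>q. \<rho>s / ?G q) has_derivative (\<lambda>h. - \<rho>s * ?P q / (?G q)\<^sup>2 * fst h))
        (at q within upto_time T \<times> UNIV)"
      using G by (auto intro!: derivative_eq_intros has_derivative_gamma_fst[OF q]
          simp: fun_eq_iff field_simps power2_eq_square)
    note \<rho>G = this
    \<comment> \<open>The product rule regrouped over plain variables, so that the exponential stays
      an atom.\<close>
    have collect: "\<rho>s / g * ((A * h + B * k) * e) + - \<rho>s * P / g\<^sup>2 * h * e =
        \<rho>s / g * e * (A - P / g) * h + \<rho>s / g * e * B * k" for g A h B k e P :: real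
      by (cases "g = 0") (simp_all add: field_simps power2_eq_square)
    from has_derivative_mult[OF \<rho>G E]
    show "((\<lambda>q. \<rho>s / ?G q * ?E q) has_derivative (\<lambda>h. ?a q * fst h + ?b q * snd h))
        (at q within upto_time T \<times> UNIV)"
      by (rule has_derivative_eq_rhs) (rule ext, rule collect)
  qed (auto intro!: continuous_intros continuous_on_gamma_fst simp: gamma_nonzero)
  then show ?thesis
    by (simp add: gaussian_def case_prod_unfold)
qed

lemma gaussian_pos: "t \<in> upto_time T \<Longrightarrow> gaussian t x > 0"
  unfolding gaussian_def using gamma_solution_pos[OF T sol] \<rho>s by simp

lemma deriv_ln_gaussian:
  assumes t: "t \<in> upto_time T"
  shows "deriv (\<lambda>y. ln (gaussian t y)) x = - 2 * \<sigma> * (x - p * t) / (\<gamma> t)\<^sup>2"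
proof (rule DERIV_imp_deriv)
  have ln_gaussian: "(\<lambda>y. ln (gaussian t y)) =
      (\<lambda>y. ln (\<rho>s / \<gamma> t) + - \<sigma> * (y - p * t)\<^sup>2 / (\<gamma> t)\<^sup>2)"
    unfolding gaussian_def using gamma_solution_pos[OF T sol t] \<rho>s by (subst ln_mult) auto
  show "((\<lambda>y. ln (gaussian t y)) has_real_derivative - 2 * \<sigma> * (x - p * t) / (\<gamma> t)\<^sup>2) (at x)"
    unfolding ln_gaussian using gamma_nonzero[OF t]
    by (auto intro!: derivative_eq_intros simp: field_simps)
qed

lemma flow_has_vector_derivative:
  assumes t: "t \<in> upto_time T"
  shows "((\<lambda>t. flow t y) has_vector_derivative flow_velocity t y) (at t within upto_time T)"
proof -
  note d = gamma_solution_derivs[OF T sol t]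
  have "((\<lambda>t. p * t + \<gamma> t * y) has_vector_derivative p + deriv_within (upto_time T) \<gamma> t * y)
      (at t within upto_time T)"
    unfolding has_real_derivative_iff_has_vector_derivative[symmetric]
    by (auto intro!: derivative_eq_intros d)
  moreover have "((\<lambda>t. deriv_within (upto_time T) \<gamma> t * y + p) has_vector_derivative
      2 * lam * \<sigma> / \<gamma> t * y) (at t within upto_time T)"
    unfolding has_real_derivative_iff_has_vector_derivative[symmetric]
    by (auto intro!: derivative_eq_intros d)
  ultimately show ?thesis
    unfolding flow_def flow_velocity_def
    by (intro has_vector_derivative_Pair has_vector_derivative_id)
      (simp_all add: add.commute)
qed

lemma flow_continuous:
  "continuous_on (upto_time T \<times> UNIV) (\<lambda>q. flow (fst q) (snd q))"
  "continuous_on (upto_time T \<times> UNIV) (\<lambda>q. flow_velocity (fst q) (snd q))"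
  unfolding flow_def flow_velocity_def
  by (auto intro!: continuous_intros continuous_on_gamma_fst simp: gamma_nonzero)

text \<open>In the Lagrangian variable \<open>y\<close>, with \<open>x = p t + \<gamma> t y\<close>, the integrand of the weak
  formulation becomes the derivative of \<open>\<alpha>\<close> along the flow, with a weight independent of time.\<close>

lemma lagrangian_integrand:
  assumes \<alpha>: "\<And>q. (\<alpha> has_derivative blinfun_apply (\<alpha>' q)) (at q)" and t: "t \<in> upto_time T"
  shows "\<gamma> t * (let x = p * t + \<gamma> t * y in gaussian t x *
           (deriv (\<lambda>s. \<alpha> (s, x, velocity t x)) t
            + velocity t x * deriv (\<lambda>y. \<alpha> (t, y, velocity t x)) x
            - lam * deriv (\<lambda>y. ln (gaussian t y)) x * deriv (\<lambda>\<xi>. \<alpha> (t, x, \<xi>)) (velocity t x)))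
         = \<rho>s * exp (- \<sigma> * y\<^sup>2) * \<alpha>' (flow t y) (flow_velocity t y)"
proof -
  define x where "x = p * t + \<gamma> t * y"
  define V where "V = deriv_within (upto_time T) \<gamma> t * y + p"
  have \<gamma>: "\<gamma> t \<noteq> 0" using gamma_nonzero[OF t] .
  have v: "velocity t x = V"
    using \<gamma> by (simp add: velocity_def x_def V_def)
  have g: "\<gamma> t * gaussian t x = \<rho>s * exp (- \<sigma> * y\<^sup>2)"
    using \<gamma> by (simp add: gaussian_def x_def power_mult_distrib)
  have l: "lam * deriv (\<lambda>y. ln (gaussian t y)) x = - (2 * lam * \<sigma> / \<gamma> t * y)"
    unfolding deriv_ln_gaussian[OF t] using \<gamma> by (simp add: x_def power2_eq_square)
  have split: "(1, V, A) = (1, 0, 0) + V *\<^sub>R (0, 1, 0) + A *\<^sub>R (0, 0, 1)" for A :: real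
    by simp
  have "\<alpha>' q (1, V, A) = \<alpha>' q (1, 0, 0) + V * \<alpha>' q (0, 1, 0) + A * \<alpha>' q (0, 0, 1)" for q A
    unfolding split by (simp only: blinfun.add_right blinfun.scaleR_right real_scaleR_def)
  then have lin: "\<alpha>' (flow t y) (flow_velocity t y) = \<alpha>' (t, x, V) (1, 0, 0) +
      V * \<alpha>' (t, x, V) (0, 1, 0) + 2 * lam * \<sigma> / \<gamma> t * y * \<alpha>' (t, x, V) (0, 0, 1)"
    by (simp add: flow_def flow_velocity_def x_def V_def)
  show ?thesis
    unfolding Let_def x_def[symmetric] v partial_derivs[OF \<alpha>] l lin mult.assoc[symmetric] g
    by simp
qed

text \<open>In the variable y the double integral becomes that of \<open>F\<close> over a box. After
  exchanging the integrals, the time integral for fixed y is a difference of boundary values of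
  \<alpha> along a characteristic, and both are zero.\<close>

lemma weak_formulation:
  assumes \<alpha>: "test_function T \<alpha>"
  shows "(LBINT t=0..T. (LBINT x. gaussian t x *
           (deriv (\<lambda>s. \<alpha> (s, x, velocity t x)) t
            + velocity t x * deriv (\<lambda>y. \<alpha> (t, y, velocity t x)) x
            - lam * deriv (\<lambda>y. ln (gaussian t y)) x * deriv (\<lambda>\<xi>. \<alpha> (t, x, \<xi>)) (velocity t x)))) = 0"
    (is "(LBINT t=0..T. (LBINT x. ?G t x)) = 0")
proof -
  obtain \<alpha>' K where \<alpha>': "\<And>q. (\<alpha> has_derivative blinfun_apply (\<alpha>' q)) (at q)" "continuous_on UNIV \<alpha>'"
    and K: "compact K" "K \<subseteq> {t. 0 < t \<and> ereal t < T} \<times> UNIV"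
    and off_K: "\<And>q. q \<notin> K \<Longrightarrow> \<alpha> q = 0" "\<And>q. q \<notin> K \<Longrightarrow> \<alpha>' q = 0"
    using \<alpha> by (rule test_function_derivative) (rule that)
  define F where "F t y = \<rho>s * exp (- \<sigma> * y\<^sup>2) * \<alpha>' (flow t y) (flow_velocity t y)" for t y
  have K_J: "fst ` K \<subseteq> upto_time T"
    using K(2) by (auto simp: upto_time_def)
  \<comment> \<open>The support lies strictly between the times a and b, so \<alpha> vanishes at
    both ends and [a,b] stays away from 0 and T.\<close>
  obtain a b where ab: "0 < a" "a < b" "ereal b < T" "fst ` K \<subseteq> {a<..<b}"
  proof (rule compact_subset_open_time_interval[OF _ _ T])
    show "compact (fst ` K)"
      using K(1) by (intro compact_continuous_image continuous_intros)
    show "fst ` K \<subseteq> {t. 0 < t \<and> ereal t < T}"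
      using K(2) by auto
  qed
  have J: "{a..b} \<subseteq> upto_time T"
    using ab by (auto simp: upto_time_def intro: le_less_trans[of _ "ereal b"])
  \<comment> \<open>This recovers the label y from a point of \<open>flow\<close>. It is continuous
    on the compact K, which gives the bound M on the labels that matter.\<close>
  let ?y = "\<lambda>q. (fst (snd q) - p * fst q) / \<gamma> (fst q)"
  have "continuous_on K (\<lambda>q. \<gamma> (fst q))"
    by (rule continuous_on_compose2[OF gamma_solution_continuous(1)[OF T sol] _ K_J])
      (intro continuous_intros)
  then have "compact (?y ` K)"
    using K_J gamma_nonzero by (intro compact_continuous_image[OF _ K(1)] continuous_intros) auto
  then obtain M where M: "\<And>q. q \<in> K \<Longrightarrow> \<bar>?y q\<bar> \<le> M"
    using compact_imp_bounded[of "?y ` K"] unfolding bounded_iff by auto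
  have flow_K: "\<bar>y\<bar> \<le> M \<and> a < t \<and> t < b" if "flow t y \<in> K" "t \<in> upto_time T" for t y
  proof -
    have "?y (flow t y) = y" "fst (flow t y) = t"
      using gamma_nonzero[OF that(2)] by (simp_all add: flow_def)
    then show ?thesis
      using M[OF that(1)] ab(4) that(1) by force
  qed
  have F_zero: "F t y = 0" if "t \<in> upto_time T" "\<not> (\<bar>y\<bar> \<le> M \<and> a < t \<and> t < b)" for t y
  proof -
    have "flow t y \<notin> K" using flow_K[OF _ that(1)] that(2) by blast
    then show ?thesis by (simp add: F_def off_K(2))
  qed
  have F_cont: "continuous_on (upto_time T \<times> UNIV) (\<lambda>q. F (fst q) (snd q))"
    unfolding F_def
    by (intro continuous_intros flow_continuous continuous_on_compose2[OF \<alpha>'(2) flow_continuous(1)]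
        bounded_bilinear.continuous_on[OF bounded_bilinear_blinfun_apply]) auto
  have F_deriv: "((\<lambda>t. \<rho>s * exp (- \<sigma> * y\<^sup>2) * \<alpha> (flow t y)) has_vector_derivative F t y)
      (at t within {a..b})" if "t \<in> {a..b}" for t y
  proof -
    have "((\<lambda>t. flow t y) has_derivative (\<lambda>h. h *\<^sub>R flow_velocity t y)) (at t within {a..b})"
      using flow_has_vector_derivative[of t y] J that unfolding has_vector_derivative_def
      by (blast intro: has_derivative_subset)
    from has_derivative_compose[OF this \<alpha>'(1)]
    have "((\<lambda>t. \<alpha> (flow t y)) has_real_derivative \<alpha>' (flow t y) (flow_velocity t y))
        (at t within {a..b})"
      by (simp add: has_field_derivative_def blinfun.scaleR_right
          mult.commute[of _ "\<alpha>' (flow t y) (flow_velocity t y)"])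
    from DERIV_cmult[OF this] show ?thesis
      unfolding F_def has_real_derivative_iff_has_vector_derivative .
  qed
  have F_int: "integral {a..b} (\<lambda>t. F t y) = 0" for y
  proof (rule integral_unique)
    have "a \<in> upto_time T" "b \<in> upto_time T"
      using J ab(2) by auto
    then have "\<alpha> (flow a y) = 0" "\<alpha> (flow b y) = 0"
      using flow_K[of a y] flow_K[of b y] by (intro off_K(1); blast)+
    then show "((\<lambda>t. F t y) has_integral 0) {a..b}"
      using fundamental_theorem_of_calculus[OF less_imp_le[OF ab(2)] F_deriv, of y] by simp
  qed
  define H where "H t = integral (cbox (- M) M) (F t)" for t
  have inner: "(LBINT x. ?G t x) = H t" if t: "t \<in> upto_time T" for t
  proof -
    have pos: "\<gamma> t > 0" using gamma_solution_pos[OF T sol t] .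
    \<comment> \<open>The change of variable x = p t + \<gamma> y has Jacobian \<gamma> > 0, which
      cancels the 1/\<gamma> of the density.\<close>
    have "(LBINT x. ?G t x) = \<gamma> t * (LBINT y. ?G t (p * t + \<gamma> t * y))"
      using lborel_integral_real_affine[of "\<gamma> t" "?G t" "p * t"] pos by simp
    also have "\<dots> = (LBINT y. \<gamma> t * ?G t (p * t + \<gamma> t * y))"
      by simp
    also have "\<dots> = (LBINT y. F t y)"
      using lagrangian_integrand[OF \<alpha>'(1) t] by (simp add: F_def Let_def)
    also have "\<dots> = (LBINT y:{- M..M}. F t y)"
    proof -
      have "F t y = indicator {- M..M} y *\<^sub>R F t y" for y
        using F_zero[OF t, of y] by (cases "y \<in> {- M..M}") (auto simp: abs_le_iff)
      then show ?thesis
        unfolding set_lebesgue_integral_def by presburger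
    qed
    also have "\<dots> = H t"
    proof -
      have "continuous_on {- M..M} (F t)"
        using continuous_on_compose2[OF F_cont, of "{- M..M}" "\<lambda>y. (t, y)"] t
          continuous_on_Pair[OF continuous_on_const continuous_on_id, of "{- M..M}" t]
        by auto
      then show ?thesis
        unfolding H_def cbox_interval
        by (intro set_borel_integral_eq_integral borel_integrable_atLeastAtMost')
    qed
    finally show ?thesis .
  qed
  have F_box: "continuous_on ({a..b} \<times> cbox (- M) M) (\<lambda>(t, y). F t y)"
    using continuous_on_subset[OF F_cont, of "{a..b} \<times> cbox (- M) M"] J
    by (auto simp: case_prod_unfold)
  have H_zero: "H t = 0" if "t \<in> upto_time T" "t \<notin> {a..b}" for t
  proof -
    have "F t = (\<lambda>_. 0)" using F_zero[OF that(1)] that(2) by (intro ext) auto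
    then show ?thesis by (simp add: H_def)
  qed
  have "(LBINT t=0..T. (LBINT x. ?G t x)) = (LBINT t:einterval 0 T. (LBINT x. ?G t x))"
    by (rule interval_lebesgue_integral_le_eq[OF less_imp_le[OF T]])
  \<comment> \<open>Inside ]0,T[ but outside [a,b] the inner integral is zero, so the possibly
    unbounded time interval shrinks to a compact one.\<close>
  also have "\<dots> = (LBINT t:{a..b}. H t)"
    unfolding set_lebesgue_integral_def
  proof (intro Bochner_Integration.integral_cong refl)
    fix t
    have e: "t \<in> einterval 0 T \<longleftrightarrow> 0 < t \<and> ereal t < T"
      by (simp add: einterval_def)
    show "indicator (einterval 0 T) t *\<^sub>R (LBINT x. ?G t x) = indicator {a..b} t *\<^sub>R H t"
    proof (cases "t \<in> einterval 0 T")
      case True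
      then have "t \<in> upto_time T" using e by (simp add: upto_time_def)
      then show ?thesis using True inner H_zero by (auto simp: indicator_def)
    next
      case False
      then have "t \<notin> {a..b}" using e J ab(1) by (auto simp: upto_time_def)
      then show ?thesis using False by simp
    qed
  qed
  also have "\<dots> = integral {a..b} H"
    unfolding H_def
    by (intro set_borel_integral_eq_integral borel_integrable_atLeastAtMost'
        integral_continuous_on_param F_box)
  \<comment> \<open>Fubini for a continuous function on a compact box.\<close>
  also have "\<dots> = integral (cbox (- M) M) (\<lambda>y. integral {a..b} (\<lambda>t. F t y))"
    using integral_swap_continuous[of a "- M" b M F] F_box
    by (simp add: H_def[abs_def] cbox_Pair_eq)
  also have "\<dots> = 0"
    using F_int by simp
  finally show ?thesis .
qed

lemma vlasov_measure_solution_gaussian: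
  "vlasov_measure_solution lam T gaussian velocity (\<lambda>t. monokinetic (gaussian t) (velocity t))"
proof -
  have "velocity t \<in> borel_measurable borel" for t
    unfolding velocity_def[abs_def] by measurable
  then show ?thesis
    unfolding vlasov_measure_solution_def
    by (intro conjI ballI allI impI refl gaussian_pos C1_gaussian C1_velocity weak_formulation
        distr_monokinetic_fst)
qed

lemma monokinetic_initial:
  "monokinetic (gaussian 0) (velocity 0) =
    monokinetic (\<lambda>x. \<rho>s * exp (- \<sigma> * x\<^sup>2)) (\<lambda>x. \<omega> * x + p)"
  by (simp add: gaussian_def[abs_def] velocity_def[abs_def] gamma_solution_initial[OF T sol])

end

theorem theorem1p1:
  fixes lam \<rho>s \<sigma>\<^sub>0 \<omega>\<^sub>0 p\<^sub>0 :: real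
  assumes "lam \<noteq> 0" and "\<rho>s > 0" and "\<sigma>\<^sub>0 > 0"
  shows
    "(\<forall>(T::ereal) \<gamma>. 0 < T \<and> gamma_solution lam \<sigma>\<^sub>0 \<omega>\<^sub>0 T \<gamma> \<longrightarrow>
        (let \<rho>\<^sub>0 = (\<lambda>x. \<rho>s * exp (- \<sigma>\<^sub>0 * x\<^sup>2));
             v\<^sub>0 = (\<lambda>x. \<omega>\<^sub>0 * x + p\<^sub>0);
             \<rho> = (\<lambda>t x. \<rho>s / \<gamma> t * exp (- \<sigma>\<^sub>0 * (x - p\<^sub>0 * t)\<^sup>2 / (\<gamma> t)\<^sup>2));
             v = (\<lambda>t x. deriv_within (upto_time T) \<gamma> t / \<gamma> t * (x - p\<^sub>0 * t) + p\<^sub>0);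
             \<mu> = (\<lambda>t. monokinetic (\<rho> t) (v t))
         in vlasov_measure_solution lam T \<rho> v \<mu> \<and> \<mu> 0 = monokinetic \<rho>\<^sub>0 v\<^sub>0)) \<and>
     (lam > 0 \<longrightarrow>
        (\<exists>\<gamma>. maximal_gamma_solution lam \<sigma>\<^sub>0 \<omega>\<^sub>0 \<infinity> \<gamma> \<and> smooth_on {0..} \<gamma> \<and>
           (\<forall>T>0. gamma_solution lam \<sigma>\<^sub>0 \<omega>\<^sub>0 T \<gamma>) \<and>
           \<gamma> \<sim>[at_top] (\<lambda>t. 2 * t * sqrt (lam * \<sigma>\<^sub>0 * ln t)) \<and>
           deriv_within {0..} \<gamma> \<sim>[at_top] (\<lambda>t. 2 * sqrt (lam * \<sigma>\<^sub>0 * ln t)))) \<and>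
     (lam < 0 \<longrightarrow>
        (\<exists>T \<gamma>. maximal_gamma_solution lam \<sigma>\<^sub>0 \<omega>\<^sub>0 T \<gamma> \<and> T < \<infinity>))"
proof (intro conjI impI allI)
  show "\<exists>\<gamma>. maximal_gamma_solution lam \<sigma>\<^sub>0 \<omega>\<^sub>0 \<infinity> \<gamma> \<and> smooth_on {0..} \<gamma> \<and>
           (\<forall>T>0. gamma_solution lam \<sigma>\<^sub>0 \<omega>\<^sub>0 T \<gamma>) \<and>
           \<gamma> \<sim>[at_top] (\<lambda>t. 2 * t * sqrt (lam * \<sigma>\<^sub>0 * ln t)) \<and>
           deriv_within {0..} \<gamma> \<sim>[at_top] (\<lambda>t. 2 * sqrt (lam * \<sigma>\<^sub>0 * ln t))" if "lam > 0"
    using that assms by (intro global_gamma_solution) simp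
  show "\<exists>T \<gamma>. maximal_gamma_solution lam \<sigma>\<^sub>0 \<omega>\<^sub>0 T \<gamma> \<and> T < \<infinity>" if "lam < 0"
    using that assms by (intro finite_time_maximal_gamma_solution) (simp add: mult_neg_pos)
next
  fix T :: ereal and \<gamma> assume "0 < T \<and> gamma_solution lam \<sigma>\<^sub>0 \<omega>\<^sub>0 T \<gamma>"
  then have T: "0 < T" and sol: "gamma_solution lam \<sigma>\<^sub>0 \<omega>\<^sub>0 T \<gamma>" by auto
  show "let \<rho>\<^sub>0 = (\<lambda>x. \<rho>s * exp (- \<sigma>\<^sub>0 * x\<^sup>2));
             v\<^sub>0 = (\<lambda>x. \<omega>\<^sub>0 * x + p\<^sub>0);
             \<rho> = (\<lambda>t x. \<rho>s / \<gamma> t * exp (- \<sigma>\<^sub>0 * (x - p\<^sub>0 * t)\<^sup>2 / (\<gamma> t)\<^sup>2));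
             v = (\<lambda>t x. deriv_within (upto_time T) \<gamma> t / \<gamma> t * (x - p\<^sub>0 * t) + p\<^sub>0);
             \<mu> = (\<lambda>t. monokinetic (\<rho> t) (v t))
         in vlasov_measure_solution lam T \<rho> v \<mu> \<and> \<mu> 0 = monokinetic \<rho>\<^sub>0 v\<^sub>0"
    using vlasov_measure_solution_gaussian[OF T sol assms(2), of p\<^sub>0]
      monokinetic_initial[OF T sol assms(2), of p\<^sub>0]
    unfolding Let_def gaussian_def[OF T sol assms(2), abs_def]
      velocity_def[OF T sol assms(2), abs_def] ..
qed

end
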